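(* Let $L$ be a Latin square of order $n$. Then the following statements are equivalent: (i) $L$ has an orthogonal mate; (ii) $\tau(L)=n$; (iii) $\chi(L_3(L,n))=n$; (iv) $d_3(L_3(L,n))=n$.
   Context: A Latin square of order $n$ is an $n\times n$ array $L=(\ell_{i,j})$ with entries from $[n]$ such that no symbol appears twice in any row or column. Two Latin squares $A=(a_{i,j})$ and $B=(b_{i,j})$ of order $n$ are orthogonal mates if the $n^2$ ordered pairs $(a_{i,j},b_{i,j})$ are distinct. A transversal in $L$ is a set of cells containing exactly one cell from each row, one from each column, and one cell of each symbol; $\tau(L)$ is the maximum number of pairwise disjoint transversals in $L$. The Latin square graph $L_3(L,n)$ has vertex set $\{(i,j)\mid 1\le i,j\le n\}$, with distinct $(i,j),(p,q)$ adjacent iff $i=p$ or $j=q$ or $\ell_{i,j}=\ell_{p,q}$. $\chi$ denotes the chromatic number. A set $S$ of vertices of a graph $G$ is $3$-dominating if every vertex outside $S$ has at least $3$ neighbours in $S$; the $3$-domatic number $d_3(G)$ is the maximum number of sets in a partition of $V(G)$ into $3$-dominating sets. *)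

theory Defs
  imports Main "HOL-Library.Disjoint_Sets"
begin

section \<open>Latin squares\<close>

definition cells :: "nat \<Rightarrow> (nat \<times> nat) set" where
  "cells n = {1..n} \<times> {1..n}"

text \<open>Only the values of \<open>L\<close> on \<open>{1..n} \<times> {1..n}\<close> are relevant.\<close>

definition latin_square :: "nat \<Rightarrow> (nat \<Rightarrow> nat \<Rightarrow> nat) \<Rightarrow> bool" where
  "latin_square n L \<longleftrightarrow>
     (\<forall>i\<in>{1..n}. \<forall>j\<in>{1..n}. L i j \<in> {1..n}) \<and>
     (\<forall>i\<in>{1..n}. inj_on (\<lambda>j. L i j) {1..n}) \<and>
     (\<forall>j\<in>{1..n}. inj_on (\<lambda>i. L i j) {1..n})"

definition orthogonal_mates :: "nat \<Rightarrow> (nat \<Rightarrow> nat \<Rightarrow> nat) \<Rightarrow> (nat \<Rightarrow> nat \<Rightarrow> nat) \<Rightarrow> bool" where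
  "orthogonal_mates n A B \<longleftrightarrow>
     latin_square n A \<and> latin_square n B \<and>
     inj_on (\<lambda>(i, j). (A i j, B i j)) (cells n)"

definition has_orthogonal_mate :: "nat \<Rightarrow> (nat \<Rightarrow> nat \<Rightarrow> nat) \<Rightarrow> bool" where
  "has_orthogonal_mate n L \<longleftrightarrow> (\<exists>B. orthogonal_mates n L B)"

definition transversal :: "nat \<Rightarrow> (nat \<Rightarrow> nat \<Rightarrow> nat) \<Rightarrow> (nat \<times> nat) set \<Rightarrow> bool" where
  "transversal n L T \<longleftrightarrow>
     T \<subseteq> cells n \<and>
     (\<forall>i\<in>{1..n}. \<exists>!c. c \<in> T \<and> fst c = i) \<and>
     (\<forall>j\<in>{1..n}. \<exists>!c. c \<in> T \<and> snd c = j) \<and>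
     (\<forall>s\<in>{1..n}. \<exists>!c. c \<in> T \<and> L (fst c) (snd c) = s)"

definition tau :: "nat \<Rightarrow> (nat \<Rightarrow> nat \<Rightarrow> nat) \<Rightarrow> nat" where
  "tau n L = Max {card F |F. (\<forall>T\<in>F. transversal n L T) \<and> disjoint F}"

section \<open>Graphs\<close>

text \<open>A simple graph is a pair of a vertex set and a set of two-element edges.
  The parameters below are meant for finite graphs: \<open>LEAST\<close>, \<open>Max\<close> and \<open>card\<close>
  need not have their intended meaning on infinite ones.\<close>

type_synonym 'a graph = "'a set \<times> 'a set set"

definition verts :: "'a graph \<Rightarrow> 'a set" where
  "verts G = fst G"

definition adj :: "'a graph \<Rightarrow> 'a \<Rightarrow> 'a \<Rightarrow> bool" where
  "adj G u v \<longleftrightarrow> {u, v} \<in> snd G"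

definition proper_colouring :: "'a graph \<Rightarrow> nat \<Rightarrow> ('a \<Rightarrow> nat) \<Rightarrow> bool" where
  "proper_colouring G k f \<longleftrightarrow>
     f ` verts G \<subseteq> {..<k} \<and>
     (\<forall>u\<in>verts G. \<forall>v\<in>verts G. adj G u v \<longrightarrow> f u \<noteq> f v)"

definition chromatic_number :: "'a graph \<Rightarrow> nat" where
  "chromatic_number G = (LEAST k. \<exists>f. proper_colouring G k f)"

definition dominating :: "nat \<Rightarrow> 'a graph \<Rightarrow> 'a set \<Rightarrow> bool" where
  "dominating k G S \<longleftrightarrow>
     S \<subseteq> verts G \<and> (\<forall>v\<in>verts G - S. k \<le> card {u \<in> S. adj G v u})"

definition domatic_number :: "nat \<Rightarrow> 'a graph \<Rightarrow> nat" where
  "domatic_number k G =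
     Max {card P |P. partition_on (verts G) P \<and> (\<forall>S\<in>P. dominating k G S)}"

definition latin_square_graph :: "nat \<Rightarrow> (nat \<Rightarrow> nat \<Rightarrow> nat) \<Rightarrow> (nat \<times> nat) graph" where
  "latin_square_graph n L =
     (cells n,
      {{(i, j), (p, q)} |i j p q.
         (i, j) \<in> cells n \<and> (p, q) \<in> cells n \<and> (i, j) \<noteq> (p, q) \<and>
         (i = p \<or> j = q \<or> L i j = L p q)})"

end

theory Submission
  imports Defs
begin

text \<open>
  Rows, columns and symbols are treated alike, as the fibres of three coordinate functions on
  cells; each fibre has \<open>n\<close> cells. A proper \<open>n\<close>-colouring is therefore a bijection onto
  the colours on every fibre, so its colour classes are transversals, and reading colours as symbols
  gives an orthogonal mate. A transversal is 3-dominating because a cell outside it is adjacent to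
  its three distinct members with the same row, column or symbol. Conversely the
  graph has degree \<open>3(n - 1)\<close>, so counting the edges that leave a 3-dominating set shows that it
  has at least \<open>n\<close> elements and is independent if it has exactly \<open>n\<close>; the \<open>n\<close> parts of
  a partition into 3-dominating sets must all have size \<open>n\<close>, hence form a proper colouring.
\<close>

section \<open>Coordinates of cells\<close>

definition coords :: "(nat \<Rightarrow> nat \<Rightarrow> nat) \<Rightarrow> (nat \<times> nat \<Rightarrow> nat) set" where
  "coords L = {fst, snd, \<lambda>c. L (fst c) (snd c)}"

lemma finite_cells [simp]: "finite (cells n)"
  by (simp add: cells_def)

lemma card_cells: "card (cells n) = n * n"
  by (simp add: cells_def card_cartesian_product)

lemma verts_latin_square_graph [simp]: "verts (latin_square_graph n L) = cells n"
  by (simp add: verts_def latin_square_graph_def)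

lemma adj_latin_square_graph:
  "adj (latin_square_graph n L) u v \<longleftrightarrow>
     u \<in> cells n \<and> v \<in> cells n \<and> u \<noteq> v \<and> (\<exists>\<kappa>\<in>coords L. \<kappa> u = \<kappa> v)"
proof -
  have "adj (latin_square_graph n L) u v \<longleftrightarrow>
      (\<exists>x y. {u, v} = {x, y} \<and> x \<in> cells n \<and> y \<in> cells n \<and> x \<noteq> y \<and> (\<exists>\<kappa>\<in>coords L. \<kappa> x = \<kappa> y))"
    by (auto simp: adj_def latin_square_graph_def coords_def)
  also have "\<dots> \<longleftrightarrow> u \<in> cells n \<and> v \<in> cells n \<and> u \<noteq> v \<and> (\<exists>\<kappa>\<in>coords L. \<kappa> u = \<kappa> v)"
    \<comment> \<open>An unordered pair can be matched in two ways; the condition on the cells is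
      symmetric, so both give the same outcome.\<close>
    unfolding doubleton_eq_iff by metis
  finally show ?thesis .
qed

lemma transversal_iff_coords:
  "transversal n L T \<longleftrightarrow>
     T \<subseteq> cells n \<and> (\<forall>\<kappa>\<in>coords L. \<forall>a\<in>{1..n}. \<exists>!c. c \<in> T \<and> \<kappa> c = a)"
  by (simp add: transversal_def coords_def)

lemma coords_range:
  assumes "latin_square n L" "\<kappa> \<in> coords L" "c \<in> cells n"
  shows "\<kappa> c \<in> {1..n}"
  using assms by (auto simp: latin_square_def coords_def cells_def)

text \<open>Injectivity along the common row or column. The square is arbitrary because the fact is
  applied both to \<open>L\<close> and, later, to an orthogonal mate \<open>B\<close>.\<close>

lemma latin_square_cell_eqI:
  assumes L: "latin_square n L" and c: "c \<in> cells n" and d: "d \<in> cells n"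
    and eq: "L (fst c) (snd c) = L (fst d) (snd d)" and line: "fst c = fst d \<or> snd c = snd d"
  shows "c = d"
proof -
  have rng: "fst c \<in> {1..n}" "snd c \<in> {1..n}" "fst d \<in> {1..n}" "snd d \<in> {1..n}"
    using c d by (auto simp: cells_def)
  have rows: "inj_on (\<lambda>j. L (fst c) j) {1..n}" and cols: "inj_on (\<lambda>i. L i (snd c)) {1..n}"
    using L rng unfolding latin_square_def by blast+
  have "fst c = fst d \<and> snd c = snd d"
    using line
  proof
    assume "fst c = fst d"
    with eq inj_onD[OF rows _ rng(2,4)] show ?thesis by simp
  next
    assume "snd c = snd d"
    with eq inj_onD[OF cols _ rng(1,3)] show ?thesis by simp
  qed
  then show ?thesis by (simp add: prod_eq_iff)
qed

text \<open>Rows and columns are products. For a symbol, an injective map of \<open>{1..n}\<close>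
  into itself is onto, so each row contains the symbol, and only once; projection to the rows is
  then a bijection from the fibre onto \<open>{1..n}\<close>.\<close>

lemma card_coord_fibre:
  assumes L: "latin_square n L" and "\<kappa> \<in> coords L" and a: "a \<in> {1..n}"
  shows "card {c \<in> cells n. \<kappa> c = a} = n"
proof -
  consider "\<kappa> = fst" | "\<kappa> = snd" | "\<kappa> = (\<lambda>c. L (fst c) (snd c))"
    using assms by (auto simp: coords_def)
  then show ?thesis
  proof cases
    case 1
    then have "{c \<in> cells n. \<kappa> c = a} = {a} \<times> {1..n}"
      using a by (auto simp: cells_def)
    then show ?thesis by (simp add: card_cartesian_product)
  next
    case 2
    then have "{c \<in> cells n. \<kappa> c = a} = {1..n} \<times> {a}"
      using a by (auto simp: cells_def)
    then show ?thesis by (simp add: card_cartesian_product)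
  next
    case 3
    let ?S = "{c \<in> cells n. \<kappa> c = a}"
    have "inj_on fst ?S"
      using 3 by (intro inj_onI latin_square_cell_eqI[OF L]) simp_all
    moreover have "fst ` ?S = {1..n}"
    proof
      show "{1..n} \<subseteq> fst ` ?S"
      proof
        fix i assume i: "i \<in> {1..n}"
        have "L i ` {1..n} = {1..n}"
          using L i unfolding latin_square_def by (intro endo_inj_surj) blast+
        then obtain j where "j \<in> {1..n}" "L i j = a" using a by (metis imageE)
        then show "i \<in> fst ` ?S" using i 3 by (force simp: cells_def)
      qed
    qed (auto simp: cells_def)
    ultimately show ?thesis using card_image[of fst ?S] by simp
  qed
qed

section \<open>Colour classes\<close>

definition independent :: "'a graph \<Rightarrow> 'a set \<Rightarrow> bool" where
  "independent G S \<longleftrightarrow> (\<forall>u\<in>S. \<forall>v\<in>S. \<not> adj G u v)"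

definition colour_class :: "'a graph \<Rightarrow> ('a \<Rightarrow> nat) \<Rightarrow> nat \<Rightarrow> 'a set" where
  "colour_class G f a = {v \<in> verts G. f v = a}"

lemma proper_colouring_of_partition:
  assumes P: "partition_on (verts G) P" "finite P" and indep: "\<forall>S\<in>P. independent G S"
  shows "\<exists>f. proper_colouring G (card P) f"
proof -
  obtain h where h: "bij_betw h P {..<card P}"
    using P(2) ex_bij_betw_finite_nat[of P] by (auto simp: atLeast0LessThan)
  have "\<forall>v\<in>verts G. \<exists>S. S \<in> P \<and> v \<in> S"
    using P(1) by (auto simp: partition_on_def)
  then obtain part where part: "\<And>v. v \<in> verts G \<Longrightarrow> part v \<in> P \<and> v \<in> part v"
    by metis
  \<comment> \<open>A vertex gets the number that \<open>h\<close> assigns to its part, so equal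
    colours mean a common part, where no two vertices are adjacent.\<close>
  have "proper_colouring G (card P) (h \<circ> part)"
    unfolding proper_colouring_def
  proof (intro conjI ballI impI)
    show "(h \<circ> part) ` verts G \<subseteq> {..<card P}"
      using part bij_betwE[OF h] by auto
  next
    fix u v assume uv: "u \<in> verts G" "v \<in> verts G" "adj G u v"
    then have "part u \<noteq> part v"
      using indep part unfolding independent_def by metis
    then show "(h \<circ> part) u \<noteq> (h \<circ> part) v"
      using uv part h by (auto simp: bij_betw_def inj_on_def)
  qed
  then show ?thesis by blast
qed

text \<open>Each fibre is a clique. The number \<open>k\<close> of colours stays arbitrary for the
  sake of the lower bound on the chromatic number.\<close>

lemma inj_on_coord_fibre:
  assumes "proper_colouring (latin_square_graph n L) k f" "\<kappa> \<in> coords L"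
  shows "inj_on f {c \<in> cells n. \<kappa> c = a}"
proof (rule inj_onI, rule ccontr)
  fix c d
  assume c: "c \<in> {c \<in> cells n. \<kappa> c = a}" and d: "d \<in> {c \<in> cells n. \<kappa> c = a}"
    and eq: "f c = f d" and ne: "c \<noteq> d"
  have "\<kappa> c = \<kappa> d" using c d by simp
  then have "adj (latin_square_graph n L) c d"
    using c d ne assms(2) unfolding adj_latin_square_graph by blast
  then show False using assms(1) c d eq by (simp add: proper_colouring_def)
qed

text \<open>On each fibre, counting shows that the colour \<open>a\<close> occurs, and injectivity
  that it occurs only once.\<close>

lemma transversal_colour_class:
  assumes L: "latin_square n L" and f: "proper_colouring (latin_square_graph n L) n f" and a: "a < n"
  shows "transversal n L (colour_class (latin_square_graph n L) f a)"
  unfolding transversal_iff_coords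
proof (intro conjI ballI)
  fix \<kappa> b assume \<kappa>: "\<kappa> \<in> coords L" and b: "b \<in> {1..n}"
  let ?S = "{c \<in> cells n. \<kappa> c = b}"
  have inj: "inj_on f ?S" by (rule inj_on_coord_fibre[OF f \<kappa>])
  have "f ` ?S \<subseteq> {..<n}" using f by (auto simp: proper_colouring_def)
  then have "f ` ?S = {..<n}"
    using card_image[OF inj] card_coord_fibre[OF L \<kappa> b] by (intro card_subset_eq) auto
  then have "a \<in> f ` ?S" using a by simp
  then obtain c where c: "c \<in> ?S" "f c = a" by blast
  have "d = c" if "d \<in> ?S" "f d = a" for d
    using inj_onD[OF inj _ that(1) c(1)] that(2) c(2) by simp
  then show "\<exists>!c. c \<in> colour_class (latin_square_graph n L) f a \<and> \<kappa> c = b"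
    using c unfolding colour_class_def verts_latin_square_graph by blast
qed (auto simp: colour_class_def)

section \<open>Transversals as independent 3-dominating sets, and partitions into them\<close>

lemma card_transversal:
  assumes "transversal n L T"
  shows "card T = n"
proof -
  have sub: "T \<subseteq> cells n" and ex1: "\<And>i. i \<in> {1..n} \<Longrightarrow> \<exists>!c. c \<in> T \<and> fst c = i"
    using assms by (simp_all add: transversal_def)
  have rng: "fst c \<in> {1..n}" if "c \<in> T" for c
    using sub that by (auto simp: cells_def)
  have "inj_on fst T"
    using ex1 rng by (intro inj_onI) metis
  moreover have "fst ` T = {1..n}"
    using ex1 rng by blast
  ultimately have "bij_betw fst T {1..n}" by (simp add: bij_betw_def)
  then show ?thesis using bij_betw_same_card by fastforce
qed

text \<open>Adjacent cells share a coordinate value in \<open>{1..n}\<close>, and \<open>T\<close>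
  contains only one cell with that value.\<close>

lemma independent_transversal:
  assumes "latin_square n L" "transversal n L T"
  shows "independent (latin_square_graph n L) T"
  unfolding independent_def adj_latin_square_graph
proof (intro ballI notI, elim conjE bexE)
  fix u v \<kappa>
  assume uv: "u \<in> T" "v \<in> T" "u \<in> cells n" "u \<noteq> v" and \<kappa>: "\<kappa> \<in> coords L" "\<kappa> u = \<kappa> v"
  have "\<exists>!c. c \<in> T \<and> \<kappa> c = \<kappa> u"
    using assms(2) \<kappa>(1) coords_range[OF assms(1) \<kappa>(1) uv(3)]
    unfolding transversal_iff_coords by blast
  then show False using uv \<kappa>(2) by auto
qed

lemma dominating_transversal:
  assumes L: "latin_square n L" and T: "transversal n L T"
  shows "dominating 3 (latin_square_graph n L) T"
  unfolding dominating_def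
proof (intro conjI ballI)
  show "T \<subseteq> verts (latin_square_graph n L)"
    using T by (simp add: transversal_def)
next
  fix v assume "v \<in> verts (latin_square_graph n L) - T"
  then have v: "v \<in> cells n" "v \<notin> T" by auto
  have Tc: "T \<subseteq> cells n" using T by (simp add: transversal_def)
  have ex: "\<exists>c. c \<in> T \<and> \<kappa> c = \<kappa> v" if "\<kappa> \<in> coords L" for \<kappa>
    using T that coords_range[OF L that v(1)] unfolding transversal_iff_coords by metis
  obtain r where r: "r \<in> T" "fst r = fst v" using ex[of fst] by (auto simp: coords_def)
  obtain c where c: "c \<in> T" "snd c = snd v" using ex[of snd] by (auto simp: coords_def)
  obtain s where s: "s \<in> T" "L (fst s) (snd s) = L (fst v) (snd v)"
    using ex[of "\<lambda>c. L (fst c) (snd c)"] by (auto simp: coords_def)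
  \<comment> \<open>If two of the three choices coincided, that cell would agree with
    \<open>v\<close> in two coordinates and so be \<open>v\<close>, which lies outside
    \<open>T\<close>.\<close>
  have "r \<noteq> c" using r c v by (metis prod_eqI)
  moreover have "r \<noteq> s"
    using latin_square_cell_eqI[OF L _ v(1), of r] r s v(2) Tc by blast
  moreover have "c \<noteq> s"
    using latin_square_cell_eqI[OF L _ v(1), of c] c s v(2) Tc by blast
  ultimately have "card {r, c, s} = 3" by simp
  moreover have "{r, c, s} \<subseteq> {u \<in> T. adj (latin_square_graph n L) v u}"
    using r c s v Tc by (auto simp: adj_latin_square_graph coords_def)
  moreover have "finite {u \<in> T. adj (latin_square_graph n L) v u}"
    using finite_subset[OF Tc finite_cells] by simp
  ultimately show "3 \<le> card {u \<in> T. adj (latin_square_graph n L) v u}"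
    by (metis card_mono)
qed

text \<open>Each class is a transversal with \<open>n\<close> cells, hence nonempty as
  \<open>1 \<le> n\<close>. This is demanded by \<open>partition_on\<close>, and it makes the
  \<open>n\<close> classes distinct.\<close>

lemma colour_class_partition:
  assumes "1 \<le> n" and L: "latin_square n L" and f: "proper_colouring (latin_square_graph n L) n f"
  defines "P \<equiv> colour_class (latin_square_graph n L) f ` {..<n}"
  shows "partition_on (cells n) P" and "card P = n"
proof -
  have ne: "colour_class (latin_square_graph n L) f a \<noteq> {}" if "a < n" for a
    using card_transversal[OF transversal_colour_class[OF L f that]] assms(1) by auto
  then have "inj_on (colour_class (latin_square_graph n L) f) {..<n}"
    by (fastforce simp: inj_on_def colour_class_def)
  then show "card P = n" by (simp add: P_def card_image)
  show "partition_on (cells n) P"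
    using ne f unfolding P_def partition_on_def disjoint_def proper_colouring_def
    by (auto simp: colour_class_def)
qed

section \<open>Edge counting for 3-dominating sets\<close>

lemma card_neighbours_le:
  assumes L: "latin_square n L" and u: "u \<in> cells n"
  shows "card {v \<in> cells n. adj (latin_square_graph n L) v u} \<le> 3 * (n - 1)"
proof -
  let ?N = "\<lambda>\<kappa>. {c \<in> cells n. \<kappa> c = \<kappa> u} - {u}"
  \<comment> \<open>Only an upper bound is possible: for \<open>n = 1\<close> the symbol function
    may coincide with \<open>fst\<close>.\<close>
  have fin: "finite (coords L)" and c3: "card (coords L) \<le> 3"
    by (auto simp: coords_def card_insert_if)
  have "card {v \<in> cells n. adj (latin_square_graph n L) v u} \<le> card (\<Union>\<kappa>\<in>coords L. ?N \<kappa>)"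
    by (rule card_mono) (auto simp: fin adj_latin_square_graph)
  also have "\<dots> \<le> (\<Sum>\<kappa>\<in>coords L. card (?N \<kappa>))"
    by (rule card_UN_le[OF fin])
  also have "\<dots> = (\<Sum>\<kappa>\<in>coords L. n - 1)"
    using u card_coord_fibre[OF L _ coords_range[OF L _ u]] by (intro sum.cong) auto
  also have "\<dots> \<le> 3 * (n - 1)" using c3 by simp
  finally show ?thesis .
qed

text \<open>At least \<open>3 * card (cells n - S)\<close> edges leave \<open>S\<close>, the degrees
  in \<open>S\<close> sum to at most \<open>card S * (3 * (n - 1))\<close>, and \<open>I\<close>
  counts the ordered adjacent pairs inside \<open>S\<close>. Together,
  \<open>3 * (n * n) + I \<le> 3 * (card S * n)\<close>. Assuming \<open>card S \<le> n\<close> lets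
  one statement serve twice: it excludes smaller sets, and it gives independence at size
  \<open>n\<close>.\<close>

lemma dominating_card_independent:
  assumes n: "1 \<le> n" and L: "latin_square n L"
    and D: "dominating 3 (latin_square_graph n L) S" and "card S \<le> n"
  shows "card S = n \<and> independent (latin_square_graph n L) S"
proof -
  let ?adj = "adj (latin_square_graph n L)"
  let ?V = "cells n"
  define I where "I = (\<Sum>u\<in>S. card {v \<in> S. ?adj v u})"
  have S: "S \<subseteq> ?V" using D by (simp add: dominating_def)
  then have fS: "finite S" using finite_subset finite_cells by blast
  have "3 * card (?V - S) \<le> (\<Sum>v\<in>?V - S. card {u \<in> S. ?adj v u})"
  proof -
    have "(\<Sum>v\<in>?V - S. 3) \<le> (\<Sum>v\<in>?V - S. card {u \<in> S. ?adj v u})"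
      using D by (intro sum_mono) (auto simp: dominating_def)
    then show ?thesis by (simp add: mult.commute)
  qed
  \<comment> \<open>Double counting of the edges between \<open>S\<close> and its complement: swap
    the two sums over an adjacency indicator.\<close>
  also have "\<dots> = (\<Sum>u\<in>S. card {v \<in> ?V - S. ?adj v u})"
    using sum.swap[of "\<lambda>v u. if ?adj v u then 1 else (0::nat)" S "?V - S"] fS
    by (simp add: sum.If_cases Int_def)
  finally have "3 * card (?V - S) + I \<le> (\<Sum>u\<in>S. card {v \<in> ?V - S. ?adj v u} + card {v \<in> S. ?adj v u})"
    by (simp add: I_def sum.distrib)
  also have "\<dots> = (\<Sum>u\<in>S. card {v \<in> ?V. ?adj v u})"
  proof (rule sum.cong)
    fix u
    have "{v \<in> ?V. ?adj v u} = {v \<in> ?V - S. ?adj v u} \<union> {v \<in> S. ?adj v u}" using S by auto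
    then show "card {v \<in> ?V - S. ?adj v u} + card {v \<in> S. ?adj v u} = card {v \<in> ?V. ?adj v u}"
      using fS by (simp, subst card_Un_disjoint) auto
  qed simp
  also have "\<dots> \<le> (\<Sum>u\<in>S. 3 * (n - 1))"
    using card_neighbours_le[OF L] S by (intro sum_mono) auto
  also have "\<dots> = card S * (3 * (n - 1))" by simp
  finally have le: "3 * card (?V - S) + I \<le> card S * (3 * (n - 1))" .
  have "card (?V - S) + card S = n * n"
    using S by (metis card_cells card_Diff_subset card_mono fS finite_cells le_add_diff_inverse2)
  \<comment> \<open>Adding \<open>3 * card S\<close> removes the truncated subtraction
    \<open>n - 1\<close>, which is a true one because \<open>1 \<le> n\<close>.\<close>
  moreover have "card S * (3 * (n - 1)) + 3 * card S = 3 * (card S * n)"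
    using n by (cases n) (auto simp: algebra_simps)
  ultimately have key: "3 * (n * n) + I \<le> 3 * (card S * n)"
    using le by linarith
  moreover have "card S * n \<le> n * n" using assms(4) by simp
  ultimately have "card S * n = n * n" and I0: "I = 0" by linarith+
  then have "card S = n" using n by simp
  moreover have "independent (latin_square_graph n L) S"
    using I0 fS by (auto simp: I_def independent_def)
  ultimately show ?thesis by blast
qed

text \<open>The sizes of the parts sum to \<open>n * n\<close>. Splitting each size into
  \<open>n\<close> plus an excess bounds the number of parts, and with \<open>n\<close> parts no
  excess is left.\<close>

lemma partition_card_parts:
  assumes "1 \<le> n" and P: "partition_on (cells n) P" and ge: "\<forall>S\<in>P. n \<le> card S"
  shows "card P \<le> n" and "card P = n \<Longrightarrow> \<forall>S\<in>P. card S = n"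
proof -
  have fP: "finite P" using P finite_elements finite_cells by blast
  have fin: "finite S" if "S \<in> P" for S
    using P that finite_cells by (metis Sup_upper finite_subset partition_onD1)
  have "n * n = (\<Sum>S\<in>P. card S)"
    using card_Union_disjoint[of P] P fin
    by (metis card_cells disjnt_def disjoint_def pairwise_def partition_onD1 partition_onD2)
  also have "\<dots> = (\<Sum>S\<in>P. n + (card S - n))"
    using ge by (intro sum.cong) auto
  also have "\<dots> = card P * n + (\<Sum>S\<in>P. card S - n)"
    by (simp add: sum.distrib)
  finally have eq: "n * n = card P * n + (\<Sum>S\<in>P. card S - n)" .
  then have "card P * n \<le> n * n" by linarith
  then show "card P \<le> n" using assms(1) by simp
  show "\<forall>S\<in>P. card S = n" if "card P = n"
    using eq that fP ge by (auto intro: le_antisym)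
qed

section \<open>Characterisations by proper colourings\<close>

text \<open>The symbols of a mate are the colours. Distinct colours along rows and columns
  correspond to the mate being Latin, distinct colours on each symbol fibre of \<open>L\<close> to
  orthogonality.\<close>

lemma has_orthogonal_mate_iff_colouring:
  assumes L: "latin_square n L"
  shows "has_orthogonal_mate n L \<longleftrightarrow> (\<exists>f. proper_colouring (latin_square_graph n L) n f)"
proof
  assume "has_orthogonal_mate n L"
  then obtain B where B: "latin_square n B" "inj_on (\<lambda>(i, j). (L i j, B i j)) (cells n)"
    by (auto simp: has_orthogonal_mate_def orthogonal_mates_def)
  \<comment> \<open>Symbols start at 1 and colours at 0. The shift keeps symbols distinct because
    they are positive.\<close>
  let ?f = "\<lambda>c. B (fst c) (snd c) - 1"
  have rng: "B (fst c) (snd c) \<in> {1..n}" if "c \<in> cells n" for c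
    using B(1) that by (auto simp: latin_square_def cells_def)
  have "proper_colouring (latin_square_graph n L) n ?f"
    unfolding proper_colouring_def
  proof (intro conjI ballI impI)
    show "?f ` verts (latin_square_graph n L) \<subseteq> {..<n}"
      using rng by fastforce
  next
    fix u v assume "adj (latin_square_graph n L) u v"
    then have uv: "u \<in> cells n" "v \<in> cells n" "u \<noteq> v"
        "fst u = fst v \<or> snd u = snd v \<or> L (fst u) (snd u) = L (fst v) (snd v)"
      by (auto simp: adj_latin_square_graph coords_def)
    have "B (fst u) (snd u) \<noteq> B (fst v) (snd v)"
    proof
      assume eq: "B (fst u) (snd u) = B (fst v) (snd v)"
      from uv(4) have "u = v"
      proof (elim disjE)
        assume "L (fst u) (snd u) = L (fst v) (snd v)"
        then show ?thesis using inj_onD[OF B(2), of u v] eq uv by (simp add: case_prod_beta)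
      qed (use latin_square_cell_eqI[OF B(1) uv(1,2) eq] in blast)+
      then show False using uv by simp
    qed
    then show "?f u \<noteq> ?f v" using rng[OF uv(1)] rng[OF uv(2)] by auto
  qed
  then show "\<exists>f. proper_colouring (latin_square_graph n L) n f" by blast
next
  assume "\<exists>f. proper_colouring (latin_square_graph n L) n f"
  then obtain f where f: "proper_colouring (latin_square_graph n L) n f" ..
  let ?B = "\<lambda>i j. Suc (f (i, j))"
  \<comment> \<open>Taking \<open>fst\<close>, \<open>snd\<close> and the symbol function for
    \<kappa> yields in turn the row condition, the column condition and orthogonality.\<close>
  have eqI: "u = v" if "u \<in> cells n" "v \<in> cells n" "f u = f v" "\<kappa> \<in> coords L" "\<kappa> u = \<kappa> v" for u v \<kappa>
    using f that unfolding proper_colouring_def adj_latin_square_graph by auto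
  have "latin_square n ?B"
    unfolding latin_square_def
  proof (intro conjI ballI)
    fix i j assume "i \<in> {1..n}" "j \<in> {1..n}"
    then have "f (i, j) < n" using f by (auto simp: proper_colouring_def cells_def image_subset_iff)
    then show "?B i j \<in> {1..n}" by simp
  next
    fix i assume "i \<in> {1..n}"
    then have "x = y" if "x \<in> {1..n}" "y \<in> {1..n}" "f (i, x) = f (i, y)" for x y
      using eqI[of "(i, x)" "(i, y)" fst] that by (simp add: cells_def coords_def)
    then show "inj_on (\<lambda>j. ?B i j) {1..n}" by (simp add: inj_on_def)
  next
    fix j assume "j \<in> {1..n}"
    then have "x = y" if "x \<in> {1..n}" "y \<in> {1..n}" "f (x, j) = f (y, j)" for x y
      using eqI[of "(x, j)" "(y, j)" snd] that by (simp add: cells_def coords_def)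
    then show "inj_on (\<lambda>i. ?B i j) {1..n}" by (simp add: inj_on_def)
  qed
  moreover have "inj_on (\<lambda>(i, j). (L i j, ?B i j)) (cells n)"
  proof (rule inj_onI)
    fix u v
    assume "u \<in> cells n" "v \<in> cells n"
      and "(case u of (i, j) \<Rightarrow> (L i j, ?B i j)) = (case v of (i, j) \<Rightarrow> (L i j, ?B i j))"
    then show "u = v"
      using eqI[of u v "\<lambda>c. L (fst c) (snd c)"] by (simp add: coords_def case_prod_beta)
  qed
  ultimately show "has_orthogonal_mate n L"
    using L by (auto simp: has_orthogonal_mate_def orthogonal_mates_def)
qed

text \<open>The first row is a clique of \<open>n\<close> cells, so no proper colouring has fewer
  than \<open>n\<close> colours.\<close>

lemma chromatic_number_eq_iff_colouring:
  assumes n: "1 \<le> n" and L: "latin_square n L"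
  shows "chromatic_number (latin_square_graph n L) = n \<longleftrightarrow>
    (\<exists>f. proper_colouring (latin_square_graph n L) n f)"
proof -
  let ?G = "latin_square_graph n L"
  have ge: "n \<le> k" if f: "proper_colouring ?G k f" for k f
  proof -
    have "fst \<in> coords L" by (simp add: coords_def)
    from card_coord_fibre[OF L this, of 1] card_image[OF inj_on_coord_fibre[OF f this, of 1]]
    have "n = card (f ` {c \<in> cells n. fst c = 1})" using n by simp
    also have "\<dots> \<le> card {..<k}"
      using f by (intro card_mono) (auto simp: proper_colouring_def)
    finally show ?thesis by simp
  qed
  \<comment> \<open>Giving all cells different colours shows that \<open>LEAST\<close> ranges over a
    nonempty set of numbers.\<close>
  obtain h where "bij_betw h (cells n) {..<card (cells n)}"
    using ex_bij_betw_finite_nat[OF finite_cells] by (auto simp: atLeast0LessThan)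
  then have "proper_colouring ?G (card (cells n)) h"
    by (auto simp: proper_colouring_def bij_betw_def adj_latin_square_graph inj_on_def)
  then have "\<exists>k f. proper_colouring ?G k f" by blast
  then have "\<exists>f. proper_colouring ?G (chromatic_number ?G) f"
    unfolding chromatic_number_def by (rule LeastI_ex)
  moreover have "chromatic_number ?G = n" if "\<exists>f. proper_colouring ?G n f"
    unfolding chromatic_number_def using that ge by (intro Least_equality) auto
  ultimately show ?thesis by auto
qed

text \<open>Reduces the claims on \<open>tau\<close> and \<open>domatic_number\<close> to whether
  the upper bound \<open>n\<close> is attained. The bound also supplies the finiteness that
  \<open>Max\<close> requires.\<close>

lemma Max_eq_iff_of_bound:
  fixes A :: "nat set"
  assumes "A \<noteq> {}" and "\<And>x. x \<in> A \<Longrightarrow> x \<le> n"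
  shows "Max A = n \<longleftrightarrow> n \<in> A"
proof -
  have "finite A" using assms(2) by (meson bounded_nat_set_is_finite le_imp_less_Suc)
  then show ?thesis using assms by (auto simp: Max_eq_iff)
qed

lemma tau_eq_iff_colouring:
  assumes n: "1 \<le> n" and L: "latin_square n L"
  shows "tau n L = n \<longleftrightarrow> (\<exists>f. proper_colouring (latin_square_graph n L) n f)"
proof -
  let ?G = "latin_square_graph n L"
  let ?A = "{card F |F. (\<forall>T\<in>F. transversal n L T) \<and> disjoint F}"
  have card_Union: "card (\<Union>F) = card F * n \<and> \<Union>F \<subseteq> cells n"
    if "\<forall>T\<in>F. transversal n L T" "disjoint F" for F
  proof -
    have sub: "\<forall>T\<in>F. T \<subseteq> cells n" using that by (simp add: transversal_def)
    then have "card (\<Union>F) = (\<Sum>T\<in>F. card T)"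
      using that(2) finite_subset[OF _ finite_cells]
      by (intro card_Union_disjoint) (auto simp: pairwise_def disjoint_def disjnt_def)
    also have "\<dots> = (\<Sum>T\<in>F. n)"
      using that(1) by (intro sum.cong) (auto intro: card_transversal)
    also have "\<dots> = card F * n" by simp
    finally show ?thesis using sub by auto
  qed
  have "x \<le> n" if "x \<in> ?A" for x
  proof -
    from that obtain F where F: "\<forall>T\<in>F. transversal n L T" "disjoint F" "x = card F" by blast
    then have "x * n \<le> n * n"
      using card_Union[of F] card_mono[of "cells n" "\<Union>F"] by (simp add: card_cells)
    then show ?thesis using n by simp
  qed
  moreover have "?A \<noteq> {}" by (auto intro!: exI[of _ "{}"])
  ultimately have "tau n L = n \<longleftrightarrow> n \<in> ?A"
    unfolding tau_def by (intro Max_eq_iff_of_bound)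
  also have "\<dots> \<longleftrightarrow> (\<exists>f. proper_colouring ?G n f)"
  proof
    assume "n \<in> ?A"
    then obtain F where F: "\<forall>T\<in>F. transversal n L T" "disjoint F" "card F = n" by blast
    \<comment> \<open>Here \<open>n\<close> disjoint transversals with \<open>n\<close> cells each
      use up all \<open>n * n\<close> cells.\<close>
    then have "\<Union>F = cells n"
      using card_Union[of F] by (intro card_subset_eq) (auto simp: card_cells)
    moreover have "{} \<notin> F" using F(1) card_transversal n by fastforce
    ultimately have "partition_on (verts ?G) F" using F(2) by (simp add: partition_on_def)
    \<comment> \<open>An infinite set has \<open>card\<close> 0, so a positive \<open>card\<close>
      forces finiteness.\<close>
    moreover have "finite F" using F(3) n by (intro card_ge_0_finite) simp
    ultimately show "\<exists>f. proper_colouring ?G n f"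
      using proper_colouring_of_partition[of ?G F] independent_transversal[OF L] F by auto
  next
    assume "\<exists>f. proper_colouring ?G n f"
    then obtain f where f: "proper_colouring ?G n f" ..
    let ?P = "colour_class ?G f ` {..<n}"
    have "\<forall>T\<in>?P. transversal n L T" using transversal_colour_class[OF L f] by auto
    moreover have "disjoint ?P" "card ?P = n"
      using colour_class_partition[OF n L f] partition_onD2 by blast+
    ultimately show "n \<in> ?A" by (intro CollectI exI[of _ ?P]) simp
  qed
  finally show ?thesis .
qed

lemma domatic_number_eq_iff_colouring:
  assumes n: "1 \<le> n" and L: "latin_square n L"
  shows "domatic_number 3 (latin_square_graph n L) = n \<longleftrightarrow>
    (\<exists>f. proper_colouring (latin_square_graph n L) n f)"
proof -
  let ?G = "latin_square_graph n L"
  let ?A = "{card P |P. partition_on (verts ?G) P \<and> (\<forall>S\<in>P. dominating 3 ?G S)}"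
  \<comment> \<open>A smaller set would satisfy \<open>card S \<le> n\<close> and so be forced to
    have exactly \<open>n\<close> elements.\<close>
  have dom_ge: "n \<le> card S" if "dominating 3 ?G S" for S
    using dominating_card_independent[OF n L that] by linarith
  have "x \<le> n" if "x \<in> ?A" for x
    using that partition_card_parts(1)[OF n] dom_ge by auto
  moreover have "?A \<noteq> {}"
  proof -
    have "(1, 1) \<in> cells n" using n by (simp add: cells_def)
    \<comment> \<open>The one-part partition is a witness: no vertex lies outside its part, so
      domination is vacuous.\<close>
    then have "partition_on (verts ?G) {cells n}" by (auto intro: partition_on_space)
    moreover have "dominating 3 ?G (cells n)" by (simp add: dominating_def)
    ultimately show ?thesis by blast
  qed
  ultimately have "domatic_number 3 ?G = n \<longleftrightarrow> n \<in> ?A"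
    unfolding domatic_number_def by (intro Max_eq_iff_of_bound)
  also have "\<dots> \<longleftrightarrow> (\<exists>f. proper_colouring ?G n f)"
  proof
    assume "n \<in> ?A"
    then obtain P where P: "partition_on (cells n) P" "\<forall>S\<in>P. dominating 3 ?G S" "card P = n"
      by auto
    have "\<forall>S\<in>P. card S = n"
      using partition_card_parts(2)[OF n P(1)] P dom_ge by blast
    then have "\<forall>S\<in>P. independent ?G S"
      using dominating_card_independent[OF n L] P(2) by simp
    moreover have "finite P" using P(3) n by (intro card_ge_0_finite) simp
    ultimately show "\<exists>f. proper_colouring ?G n f"
      using proper_colouring_of_partition[of ?G P] P by simp
  next
    assume "\<exists>f. proper_colouring ?G n f"
    then obtain f where f: "proper_colouring ?G n f" ..
    let ?P = "colour_class ?G f ` {..<n}"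
    have "\<forall>S\<in>?P. dominating 3 ?G S"
      using dominating_transversal[OF L] transversal_colour_class[OF L f] by auto
    then show "n \<in> ?A"
      using colour_class_partition[OF n L f] by (intro CollectI exI[of _ ?P]) simp
  qed
  finally show ?thesis .
qed

text \<open>A proper colouring with \<open>n\<close> colours is the common middle term: each of the
  four properties is equivalent to its existence.\<close>

theorem theorem2p5:
  fixes n :: nat and L :: "nat \<Rightarrow> nat \<Rightarrow> nat"
  assumes "1 \<le> n" and "latin_square n L"
  shows "(has_orthogonal_mate n L \<longleftrightarrow> tau n L = n) \<and>
         (tau n L = n \<longleftrightarrow> chromatic_number (latin_square_graph n L) = n) \<and>
         (chromatic_number (latin_square_graph n L) = n \<longleftrightarrow>
            domatic_number 3 (latin_square_graph n L) = n)"
  using has_orthogonal_mate_iff_colouring[OF assms(2)] tau_eq_iff_colouring[OF assms]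
    chromatic_number_eq_iff_colouring[OF assms] domatic_number_eq_iff_colouring[OF assms]
  by simp

end
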